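(* For every positive integer $k$, there is a graph $G_k$ that is a union of cycles sharing a single common vertex (and otherwise pairwise vertex-disjoint) such that $z(G_k)\geq k$.
   Context: The game of Zombies and Survivor on a finite connected graph: first a set of zombies is placed on vertices, then a single survivor chooses a vertex. Then the players alternate rounds: each zombie moves along an edge following some shortest path (geodesic) from its current position to the survivor, so each zombie's distance to the survivor decreases by one (if several shortest paths exist, the zombies may choose which one to follow — the deterministic version); then the survivor moves to an adjacent vertex or stays put. The zombies win if some zombie moves onto the vertex of the survivor. The zombie number $z(G)$ is the minimum number of zombies such that the zombies have a strategy guaranteeing capture of the survivor in finite time regardless of how the survivor plays. *)

theory Defs
  imports "Graph_Theory.Graph_Theory"
begin

text \<open>
  Finite simple graphs are modelled by \<^locale>\<open>pair_graph\<close>: finite, loopless, symmetric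
  digraphs whose arcs are pairs of vertices.
\<close>

section \<open>Cycles sharing a single vertex\<close>

text \<open>
  In a symmetric digraph the closed walk u, v, u is a cycle in the sense of
  \<^const>\<open>pre_digraph.cycle\<close>; the bound on the length excludes it.
\<close>

definition cycle_graph :: "'a pair_pre_digraph \<Rightarrow> bool" where
  "cycle_graph C \<longleftrightarrow> pair_graph C \<and>
     (\<exists>p. pre_digraph.cycle (with_proj C) p \<and> 3 \<le> length p \<and>
          pverts C = fst ` set p \<and> parcs C = set p \<union> (set p)\<inverse>)"

definition cycles_sharing_vertex :: "'a pair_pre_digraph \<Rightarrow> bool" where
  "cycles_sharing_vertex G \<longleftrightarrow>
     (\<exists>\<C> v. finite \<C> \<and> \<C> \<noteq> {} \<and>
        (\<forall>C\<in>\<C>. cycle_graph C \<and> v \<in> pverts C) \<and>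
        (\<forall>C\<in>\<C>. \<forall>D\<in>\<C>. C \<noteq> D \<longrightarrow> pverts C \<inter> pverts D = {v}) \<and>
        pverts G = (\<Union>C\<in>\<C>. pverts C) \<and> parcs G = (\<Union>C\<in>\<C>. parcs C))"

section \<open>Zombies and Survivor\<close>

definition geodesic :: "'a pair_pre_digraph \<Rightarrow> 'a \<Rightarrow> ('a \<times> 'a) awalk \<Rightarrow> 'a \<Rightarrow> bool" where
  "geodesic G u p v \<longleftrightarrow> pre_digraph.awalk (with_proj G) u p v \<and>
     (\<forall>q. pre_digraph.awalk (with_proj G) u q v \<longrightarrow> length p \<le> length q)"

text \<open>A zombie at \<open>z\<close> moves to \<open>z'\<close> while the survivor is at \<open>s\<close>.\<close>

definition zombie_step :: "'a pair_pre_digraph \<Rightarrow> 'a \<Rightarrow> 'a \<Rightarrow> 'a \<Rightarrow> bool" where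
  "zombie_step G s z z' \<longleftrightarrow> (\<exists>p. geodesic G z ((z, z') # p) s)"

text \<open>
  \<open>s t\<close> is the position of the survivor during the zombies' move of round \<open>t\<close>;
  \<open>s 0\<close> is the initial position.
\<close>

definition survivor_trajectory :: "'a pair_pre_digraph \<Rightarrow> (nat \<Rightarrow> 'a) \<Rightarrow> bool" where
  "survivor_trajectory G s \<longleftrightarrow>
     s 0 \<in> pverts G \<and> (\<forall>t. s (Suc t) = s t \<or> (s t, s (Suc t)) \<in> parcs G)"

text \<open>
  A strategy \<open>\<sigma>\<close> maps the list of the survivor's positions so far to the list of the
  zombies' positions; \<open>\<sigma> []\<close> is the initial placement, which is made before the survivor
  appears. Several zombies may occupy the same vertex. Since the zombies' earlier positions
  are determined by \<open>\<sigma>\<close> and the survivor's history, this covers strategies that depend on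
  the whole history of the game.
\<close>

type_synonym 'a zombie_strategy = "'a list \<Rightarrow> 'a list"

definition zombie_pos :: "'a zombie_strategy \<Rightarrow> (nat \<Rightarrow> 'a) \<Rightarrow> nat \<Rightarrow> 'a list" where
  "zombie_pos \<sigma> s t = \<sigma> (map s [0..<t])"

text \<open>
  The survivor has been caught before the zombies' move of round \<open>t\<close>: at some \<open>i \<le> t\<close> he
  stands on a zombie's vertex (by having chosen it or stepped onto it), or at some
  \<open>i < t\<close> a zombie moved onto his vertex.
\<close>

definition caught_before :: "'a zombie_strategy \<Rightarrow> (nat \<Rightarrow> 'a) \<Rightarrow> nat \<Rightarrow> bool" where
  "caught_before \<sigma> s t \<longleftrightarrow>
     (\<exists>i\<le>t. s i \<in> set (zombie_pos \<sigma> s i)) \<or> (\<exists>i<t. s i \<in> set (zombie_pos \<sigma> s (Suc i)))"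

text \<open>
  The rules bind the zombies only as long as the survivor has not been caught, as the game
  ends then.
\<close>

definition legal_strategy :: "'a pair_pre_digraph \<Rightarrow> 'a zombie_strategy \<Rightarrow> bool" where
  "legal_strategy G \<sigma> \<longleftrightarrow> set (\<sigma> []) \<subseteq> pverts G \<and>
     (\<forall>s t. survivor_trajectory G s \<and> \<not> caught_before \<sigma> s t \<longrightarrow>
        list_all2 (zombie_step G (s t)) (zombie_pos \<sigma> s t) (zombie_pos \<sigma> s (Suc t)))"

definition winning_strategy :: "'a pair_pre_digraph \<Rightarrow> 'a zombie_strategy \<Rightarrow> bool" where
  "winning_strategy G \<sigma> \<longleftrightarrow> legal_strategy G \<sigma> \<and>
     (\<forall>s. survivor_trajectory G s \<longrightarrow> (\<exists>t. caught_before \<sigma> s t))"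

definition zombies_can_win :: "'a pair_pre_digraph \<Rightarrow> nat \<Rightarrow> bool" where
  "zombies_can_win G n \<longleftrightarrow> (\<exists>\<sigma>. length (\<sigma> []) = n \<and> winning_strategy G \<sigma>)"

definition zombie_number :: "'a pair_pre_digraph \<Rightarrow> nat" where
  "zombie_number G = (LEAST n. zombies_can_win G n)"

text \<open>The minimum is attained, as one zombie on every vertex suffices.\<close>

lemma zombies_can_win_card:
  assumes "pair_graph G"
  shows "zombies_can_win G (card (pverts G))"
proof -
  interpret pair_graph G by fact
  obtain xs where xs: "set xs = pverts G" "length xs = card (pverts G)"
    using pair_finite_verts finite_distinct_list distinct_card by metis
  have "caught_before (\<lambda>_. xs) s t" if "survivor_trajectory G s" for s t
    using that xs by (auto simp: caught_before_def zombie_pos_def survivor_trajectory_def)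
  then have "winning_strategy G (\<lambda>_. xs)"
    using xs by (auto simp: winning_strategy_def legal_strategy_def)
  then show ?thesis
    unfolding zombies_can_win_def using xs by (intro exI[of _ "\<lambda>_. xs"]) simp
qed

lemma zombies_can_win_zombie_number:
  "pair_graph G \<Longrightarrow> zombies_can_win G (zombie_number G)"
  unfolding zombie_number_def by (rule LeastI) (rule zombies_can_win_card)

end

theory Submission
  imports Defs
begin

text \<open>
  The survivor never reacts to the zombies. Take cycles of lengths \<open>8 * 4 ^ i\<close>, several of each
  length, so that every length occurs on a cycle without zombies; he only runs forward along such
  cycles. Until a zombie reaches the hub, each of its moves brings it one step closer to the hub,
  so its arrival time there is known in advance. If it arrives when the survivor is \<open>d \<ge> 2\<close> steps
  past the hub and from then on all cycles he uses are longer than \<open>2 * d\<close>, the unique shortest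
  path to him is the one he took, and the zombie repeats his walk forever with delay \<open>d\<close>. On
  entering a cycle of length \<open>l\<close> the survivor thus only has to avoid arrivals in the second half
  of that round. For lengths growing by a factor of 4 these bad time windows are disjoint, so
  one of \<open>m + 1\<close> consecutive lengths is safe against \<open>m\<close> zombies. He must use longer cycles
  only when some zombie has joined the ones behind him, so finitely many lengths suffice.
\<close>

section \<open>Distances on a cycle\<close>

text \<open>The shorter of the two arcs between \<open>a\<close> and \<open>b\<close>; the case
  split makes all subtractions exact for positions below \<open>l\<close>.\<close>

definition cycle_dist :: "nat \<Rightarrow> nat \<Rightarrow> nat \<Rightarrow> nat" where
  "cycle_dist l a b =
    (if b \<le> a then min (a - b) (l + b - a) else min (b - a) (l + a - b))"

definition cycle_suc :: "nat \<Rightarrow> nat \<Rightarrow> nat" where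
  "cycle_suc l p = (if Suc p = l then 0 else Suc p)"

definition cycle_pred :: "nat \<Rightarrow> nat \<Rightarrow> nat" where
  "cycle_pred l p = (if p = 0 then l - 1 else p - 1)"

lemma cycle_suc_less: "p < l \<Longrightarrow> cycle_suc l p < l"
  and cycle_pred_less: "p < l \<Longrightarrow> cycle_pred l p < l"
  by (auto simp: cycle_suc_def cycle_pred_def)

lemma cycle_dist_cycle_suc:
  assumes "a < l" "p < l"
  shows "cycle_dist l a p \<le> Suc (cycle_dist l a (cycle_suc l p)) \<and>
    cycle_dist l a (cycle_suc l p) \<le> Suc (cycle_dist l a p)"
proof (cases "p < a")
  case True
  \<comment> \<open>Writing positions as sums with explicit gaps removes truncated subtraction and
    leaves linear arithmetic about minima.\<close>
  then obtain k where a: "a = Suc (p + k)" using less_imp_Suc_add by blast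
  obtain m where l: "l = Suc (a + m)" using assms(1) less_imp_Suc_add by blast
  have "cycle_dist l a p = min (Suc k) (Suc (p + m))"
    by (simp add: cycle_dist_def l a)
  moreover have "cycle_dist l a (cycle_suc l p) = min k (Suc (Suc (p + m)))"
    by (simp add: cycle_dist_def cycle_suc_def l a)
  ultimately show ?thesis by linarith
next
  case False
  then obtain k where p: "p = a + k" by (metis le_Suc_ex not_less)
  obtain m where l: "l = Suc (p + m)" using assms(2) less_imp_Suc_add by blast
  have "cycle_dist l a p = min k (Suc (a + m))"
    by (cases k) (simp_all add: ac_simps cycle_dist_def l p)
  moreover have "cycle_dist l a (cycle_suc l p) = min (Suc k) (a + m)"
    by (cases m) (simp_all add: ac_simps cycle_dist_def cycle_suc_def l p)
  ultimately show ?thesis by linarith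
qed

lemma cycle_dist_commute: "cycle_dist l a b = cycle_dist l b a"
  by (auto simp: cycle_dist_def)

lemma cycle_dist_add: "cycle_dist l (r + e) r = min e (l - e)"
  by (auto simp: cycle_dist_def)

lemma cycle_dist_eq_0_iff: "a < l \<Longrightarrow> b < l \<Longrightarrow> cycle_dist l a b = 0 \<longleftrightarrow> a = b"
  by (auto simp: cycle_dist_def min_def)

text \<open>Move \<open>p\<close> along the shorter arc towards \<open>a\<close>; the inner case
  splits ask which arc that is.\<close>

lemma cycle_dist_descent:
  assumes "a < l" "p < l" "a \<noteq> p"
  shows "cycle_dist l a p = Suc (cycle_dist l a (cycle_suc l p)) \<or>
    cycle_dist l a p = Suc (cycle_dist l a (cycle_pred l p))"
proof (cases "p < a")
  case True
  then obtain k where a: "a = Suc (p + k)" using less_imp_Suc_add by blast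
  obtain m where l: "l = Suc (a + m)" using assms(1) less_imp_Suc_add by blast
  have dist: "cycle_dist l a p = min (Suc k) (Suc (p + m))"
    by (simp add: cycle_dist_def l a)
  show ?thesis
  proof (cases "Suc k \<le> Suc (p + m)")
    case T: True
    have "cycle_dist l a (cycle_suc l p) = min k (Suc (Suc (p + m)))"
      by (simp add: cycle_dist_def cycle_suc_def l a)
    with T dist show ?thesis by (simp add: min_def)
  next
    case F: False
    have "cycle_dist l a (cycle_pred l p) = min (Suc (Suc k)) (p + m)"
      by (cases p) (simp_all add: ac_simps cycle_dist_def cycle_pred_def l a)
    with F dist show ?thesis by (simp add: min_def)
  qed
next
  case False
  with assms(3) obtain k where p: "p = Suc (a + k)"
    using less_imp_Suc_add linorder_neqE_nat by metis
  obtain m where l: "l = Suc (p + m)" using assms(2) less_imp_Suc_add by blast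
  have dist: "cycle_dist l a p = min (Suc k) (Suc (a + m))"
    by (simp add: cycle_dist_def l p)
  show ?thesis
  proof (cases "Suc k \<le> Suc (a + m)")
    case T: True
    have "cycle_dist l a (cycle_pred l p) = min k (Suc (Suc (a + m)))"
      by (simp add: ac_simps cycle_dist_def cycle_pred_def l p)
    with T dist show ?thesis by (simp add: min_def)
  next
    case F: False
    have "cycle_dist l a (cycle_suc l p) = min (Suc (Suc k)) (a + m)"
      by (cases m) (simp_all add: ac_simps cycle_dist_def cycle_suc_def l p)
    with F dist show ?thesis by (simp add: min_def)
  qed
qed

section \<open>Bouquets of cycles\<close>

locale bouquet =
  fixes L :: "nat \<Rightarrow> nat" and N :: nat
  assumes length_ge_3: "3 \<le> L c" and N_pos: "0 < N"
begin

lemma L_pos [simp]: "0 < L c" "Suc 0 < L c" "L c \<noteq> 0"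
  using length_ge_3[of c] by auto

definition hub :: nat where
  "hub = prod_encode (0, 0)"

text \<open>Position 0 of every cycle is glued to the hub. Reading positions modulo the length makes
  \<open>vt c\<close> run around cycle \<open>c\<close> periodically, without a wrap-around
  case.\<close>

definition vt :: "nat \<Rightarrow> nat \<Rightarrow> nat" where
  "vt c p = (if p mod L c = 0 then hub else prod_encode (c, p mod L c))"

definition cycle_arcs :: "nat \<Rightarrow> (nat \<times> nat) set" where
  "cycle_arcs c = (\<lambda>p. (vt c p, vt c (Suc p))) ` {..<L c}"

definition cyc :: "nat \<Rightarrow> nat pair_pre_digraph" where
  "cyc c = \<lparr>pverts = vt c ` {..<L c}, parcs = cycle_arcs c \<union> (cycle_arcs c)\<inverse>\<rparr>"

definition G :: "nat pair_pre_digraph" where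
  "G = \<lparr>pverts = (\<Union>c<N. pverts (cyc c)), parcs = (\<Union>c<N. parcs (cyc c))\<rparr>"

lemma vt_0 [simp]: "vt c 0 = hub" and vt_L [simp]: "vt c (L c) = hub"
  by (auto simp: vt_def)

lemma vt_eq_iff:
  "p < L c \<Longrightarrow> p' < L c' \<Longrightarrow>
    vt c p = vt c' p' \<longleftrightarrow> p = 0 \<and> p' = 0 \<or> c = c' \<and> p = p'"
  by (auto simp: vt_def hub_def)

lemma vt_eq_hub_iff: "p < L c \<Longrightarrow> vt c p = hub \<longleftrightarrow> p = 0"
  by (auto simp: vt_def hub_def)

lemma vt_mod [simp]: "vt c (p mod L c) = vt c p"
  by (simp add: vt_def)

lemma pverts_cyc: "pverts (cyc c) = range (vt c)"
proof -
  have "vt c p \<in> vt c ` {..<L c}" for p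
    using vt_mod[of c p] by (metis L_pos(1) imageI lessThan_iff mod_less_divisor)
  then show ?thesis by (auto simp: cyc_def)
qed

lemma vt_in_pverts: "c < N \<Longrightarrow> vt c p \<in> pverts G"
  by (auto simp: G_def pverts_cyc)

lemma pverts_G_cases:
  assumes "z \<in> pverts G"
  obtains c p where "c < N" "p < L c" "z = vt c p"
  using assms by (auto simp: G_def cyc_def)

lemma arc_cases:
  assumes "(z, z') \<in> parcs G"
  obtains c p where "c < N" "p < L c" "z = vt c p" "z' = vt c (Suc p)"
  | c p where "c < N" "p < L c" "z' = vt c p" "z = vt c (Suc p)"
  using assms by (auto simp: G_def cyc_def cycle_arcs_def)

lemma arc_SucI:
  assumes "c < N"
  shows "(vt c p, vt c (Suc p)) \<in> parcs G" "(vt c (Suc p), vt c p) \<in> parcs G"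
proof -
  have "vt c (Suc p) = vt c (Suc (p mod L c))"
    by (simp add: vt_def mod_Suc_eq)
  moreover have "p mod L c < L c" by simp
  ultimately have "(vt c p, vt c (Suc p)) \<in> cycle_arcs c"
    by (auto simp: cycle_arcs_def intro!: image_eqI[of _ _ "p mod L c"])
  with assms show "(vt c p, vt c (Suc p)) \<in> parcs G" "(vt c (Suc p), vt c p) \<in> parcs G"
    by (auto simp: G_def cyc_def)
qed

lemma vt_neq_Suc: "vt c p \<noteq> vt c (Suc p)"
  using length_ge_3[of c] by (auto simp: vt_def hub_def mod_Suc)

section \<open>Cycles glued at the hub\<close>

lemma pair_graph_cyc: "pair_graph (cyc c)"
proof
  have arcs: "e \<in> parcs (cyc c) \<Longrightarrow> \<exists>p. e = (vt c p, vt c (Suc p)) \<or> e = (vt c (Suc p), vt c p)" for e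
    by (auto simp: cyc_def cycle_arcs_def)
  fix e assume "e \<in> parcs (cyc c)"
  from arcs[OF this] show "fst e \<in> pverts (cyc c)" "snd e \<in> pverts (cyc c)" "fst e \<noteq> snd e"
    by (auto simp: pverts_cyc vt_neq_Suc vt_neq_Suc[symmetric])
next
  show "finite (pverts (cyc c))" "finite (parcs (cyc c))"
    by (auto simp: cyc_def cycle_arcs_def)
  show "symmetric (with_proj (cyc c))"
    by (auto simp: symmetric_def cyc_def intro!: symI)
qed

lemma cycle_graph_cyc: "cycle_graph (cyc c)"
proof -
  interpret C: pair_graph "cyc c" by (rule pair_graph_cyc)
  define p where "p = map (\<lambda>i. (vt c i, vt c (Suc i))) [0..<L c]"
  have cas: "pcas (vt c a) (map (\<lambda>i. (vt c i, vt c (Suc i))) [a..<a + m]) (vt c (a + m))" for a m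
  proof (induction m arbitrary: a)
    case (Suc m)
    show ?case using Suc[of "Suc a"] by (simp add: upt_conv_Cons del: upt_Suc)
  qed simp
  have set_p: "set p = cycle_arcs c"
    by (auto simp: p_def cycle_arcs_def)
  have p_ne: "p \<noteq> []" by (simp add: p_def)
  have cas_p: "pcas hub p hub"
    using cas[of 0 "L c"] by (simp add: p_def)
  have "C.awalk hub p hub"
    unfolding C.awalk_def using cas_p
    by (simp add: set_p) (auto simp: cyc_def intro!: image_eqI[of _ _ 0])
  moreover have "pawalk_verts hub p = hub # map snd p"
    using C.awalk_verts_conv'[of hub p hub] cas_p p_ne by (cases p) auto
  \<comment> \<open>A cycle needs distinct vertices after the first one, that is, distinct heads of
    its arcs; the hub occurs there only at the end.\<close>
  moreover have "inj_on (\<lambda>i. vt c (Suc i)) {..<L c}"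
  proof (rule inj_onI)
    fix i j assume "i \<in> {..<L c}" "j \<in> {..<L c}" "vt c (Suc i) = vt c (Suc j)"
    then show "i = j"
      by (auto simp: vt_def hub_def mod_Suc split: if_splits)
  qed
  then have "distinct (map snd p)"
    by (simp add: p_def distinct_map comp_def lessThan_atLeast0)
  ultimately have "C.cycle p"
    unfolding C.cycle_def using p_ne by auto
  moreover have "pverts (cyc c) = fst ` set p"
    by (simp add: set_p cycle_arcs_def cyc_def image_image)
  moreover have "3 \<le> length p" using length_ge_3[of c] by (simp add: p_def)
  ultimately show ?thesis
    unfolding cycle_graph_def using set_p
    by (intro conjI exI[of _ p] pair_graph_cyc) (auto simp: cyc_def)
qed

lemma cycles_sharing_vertex_G: "cycles_sharing_vertex G"
  unfolding cycles_sharing_vertex_def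
proof (intro exI[of _ "cyc ` {..<N}"] exI[of _ hub] conjI ballI impI)
  have hub_in: "hub \<in> pverts (cyc c)" for c
    unfolding pverts_cyc by (metis rangeI vt_0)
  fix C assume "C \<in> cyc ` {..<N}"
  then obtain c where c: "C = cyc c" by auto
  show "cycle_graph C" "hub \<in> pverts C" by (simp_all add: c cycle_graph_cyc hub_in)
  fix D assume "D \<in> cyc ` {..<N}" "C \<noteq> D"
  then obtain d where d: "D = cyc d" "c \<noteq> d" using c by auto
  have "x = hub" if "x \<in> pverts C" "x \<in> pverts D" for x
    using that d unfolding c d by (auto simp: cyc_def vt_eq_iff)
  then show "pverts C \<inter> pverts D = {hub}"
    using hub_in c d by blast
qed (use N_pos in \<open>auto simp: G_def\<close>)

lemma pair_graph_G: "pair_graph G"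
proof
  fix e assume "e \<in> parcs G"
  then show "fst e \<in> pverts G" "snd e \<in> pverts G" "fst e \<noteq> snd e"
    by (cases e; auto elim!: arc_cases simp: vt_in_pverts vt_neq_Suc vt_neq_Suc[symmetric])+
next
  show "finite (pverts G)" "finite (parcs G)"
    by (auto simp: G_def cyc_def cycle_arcs_def)
  show "symmetric (with_proj G)"
    by (auto simp: symmetric_def G_def cyc_def intro!: symI)
qed

sublocale G: pair_graph G
  by (rule pair_graph_G)

section \<open>Graph distance in the bouquet\<close>

text \<open>The hub separates different cycles, so distances add up there. It decodes to position 0
  of cycle 0, but its other representations give the same value, as position 0 is at distance 0 from
  the hub.\<close>

definition dst :: "nat \<Rightarrow> nat \<Rightarrow> nat" where
  "dst x z = (case prod_decode x of (c, q) \<Rightarrow> case prod_decode z of (c', p) \<Rightarrow>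
     if c = c' then cycle_dist (L c) q p else cycle_dist (L c) q 0 + cycle_dist (L c') p 0)"

lemma dst_vt:
  "q < L c \<Longrightarrow> p < L c' \<Longrightarrow> dst (vt c q) (vt c' p) =
     (if c = c' then cycle_dist (L c) q p else cycle_dist (L c) q 0 + cycle_dist (L c') p 0)"
  by (auto simp: dst_def vt_def hub_def cycle_dist_def)

lemma vt_Suc: "p < L c \<Longrightarrow> vt c (Suc p) = vt c (cycle_suc (L c) p)"
  by (simp add: cycle_suc_def)

lemma vt_Suc_cycle_pred: "p < L c \<Longrightarrow> vt c (Suc (cycle_pred (L c) p)) = vt c p"
  by (simp add: cycle_pred_def)

text \<open>An arc lies on one cycle, so moving along it changes a single \<open>cycle_dist\<close>
  by at most one. This makes \<open>dst\<close> a lower bound for walk lengths.\<close>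

lemma dst_arc:
  assumes "x \<in> pverts G" "(z, z') \<in> parcs G"
  shows "dst x z \<le> Suc (dst x z')"
proof -
  obtain c q where x: "q < L c" "x = vt c q" using assms(1) by (rule pverts_G_cases)
  have *: "dst x (vt c' p) \<le> Suc (dst x (vt c' (Suc p))) \<and> dst x (vt c' (Suc p)) \<le> Suc (dst x (vt c' p))"
    if "p < L c'" for c' p
    using that x cycle_dist_cycle_suc[of q "L c" p] cycle_dist_cycle_suc[of 0 "L c'" p]
    by (cases "c = c'") (simp_all add: dst_vt vt_Suc cycle_suc_less cycle_dist_commute[of _ _ 0])
  from assms(2) show ?thesis using * by (cases rule: arc_cases) auto
qed

lemma dst_eq_0_iff:
  assumes "x \<in> pverts G" "z \<in> pverts G"
  shows "dst x z = 0 \<longleftrightarrow> x = z"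
proof -
  obtain c q where x: "q < L c" "x = vt c q" using assms(1) by (rule pverts_G_cases)
  obtain c' p where z: "p < L c'" "z = vt c' p" using assms(2) by (rule pverts_G_cases)
  show ?thesis using x z by (auto simp: dst_vt vt_eq_iff cycle_dist_eq_0_iff)
qed

text \<open>The step follows the shorter arc to \<open>x\<close>, or to the hub if \<open>x\<close>
  is on another cycle. Iterating it gives walks of length \<open>dst x z\<close>.\<close>

lemma dst_descent:
  assumes "x \<in> pverts G" "z \<in> pverts G" "x \<noteq> z"
  shows "\<exists>z'. (z, z') \<in> parcs G \<and> dst x z = Suc (dst x z')"
proof -
  obtain c q where x: "c < N" "q < L c" "x = vt c q" using assms(1) by (rule pverts_G_cases)
  \<comment> \<open>The hub is represented on the cycle of \<open>x\<close>; any other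
    \<open>z\<close> off that cycle can still move towards the hub.\<close>
  obtain c' p where z: "c' < N" "p < L c'" "z = vt c' p" "c' \<noteq> c \<Longrightarrow> p \<noteq> 0"
  proof -
    obtain c' p where z: "c' < N" "p < L c'" "z = vt c' p" using assms(2) by (rule pverts_G_cases)
    show thesis
    proof (cases "p = 0")
      case True
      then have "z = vt c 0" by (simp add: z)
      with x show thesis by (intro that[of c 0]) auto
    qed (use z that in blast)
  qed
  have ne: "c = c' \<Longrightarrow> q \<noteq> p"
    using assms(3) x z by auto
  have "dst x z = Suc (dst x (vt c' (cycle_suc (L c') p))) \<or>
      dst x z = Suc (dst x (vt c' (cycle_pred (L c') p)))"
    using x z ne cycle_dist_descent[of q "L c" p] cycle_dist_descent[of 0 "L c'" p]
    by (auto simp: dst_vt cycle_suc_less cycle_pred_less cycle_dist_commute[of _ _ 0])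
  moreover have "(z, vt c' (cycle_suc (L c') p)) \<in> parcs G"
    using arc_SucI(1)[OF z(1), of p] z by (simp add: vt_Suc)
  moreover have "(z, vt c' (cycle_pred (L c') p)) \<in> parcs G"
    using arc_SucI(2)[OF z(1), of "cycle_pred (L c') p"] z by (simp add: vt_Suc_cycle_pred)
  ultimately show ?thesis by blast
qed

lemma dst_le_length_awalk:
  "G.awalk z p x \<Longrightarrow> dst x z \<le> length p"
proof (induction p arbitrary: z)
  case Nil
  then show ?case by (auto simp: G.awalk_Nil_iff dst_eq_0_iff)
next
  case (Cons e p)
  then have "e \<in> parcs G" "fst e = z" and p: "G.awalk (snd e) p x"
    by (auto simp: G.awalk_Cons_iff)
  then have "dst x z \<le> Suc (dst x (snd e))"
    using G.awalk_last_in_verts[OF p] by (intro dst_arc) auto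
  with Cons.IH[OF p] show ?case by simp
qed

lemma awalk_dst:
  assumes "x \<in> pverts G" "z \<in> pverts G"
  shows "\<exists>p. G.awalk z p x \<and> length p = dst x z"
  using assms(2)
proof (induction "dst x z" arbitrary: z)
  case 0
  then have "z = x" using assms dst_eq_0_iff by metis
  then show ?case using 0 by (intro exI[of _ "[]"]) (auto simp: G.awalk_Nil_iff)
next
  case (Suc n)
  then have "x \<noteq> z" using assms dst_eq_0_iff by force
  then obtain z' where z': "(z, z') \<in> parcs G" "dst x z = Suc (dst x z')"
    using dst_descent Suc assms by blast
  with Suc obtain p where "G.awalk z' p x" "length p = dst x z'"
    by (metis G.in_arcsD2 Suc_inject)
  with z' show ?case by (intro exI[of _ "(z, z') # p"]) (auto simp: G.awalk_Cons_iff)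
qed

lemma connected_G: "Digraph_Component.connected (with_proj G)"
proof -
  have "parcs (mk_symmetric (with_proj G)) = parcs G"
    using G.arcs_symmetric by (auto simp: parcs_mk_symmetric)
  then have eq: "mk_symmetric (with_proj G) = G"
    by (intro pair_pre_digraph.equality) simp_all
  have "strongly_connected (with_proj G)"
  proof (rule strongly_connectedI)
    show "verts (with_proj G) \<noteq> {}" using vt_in_pverts[OF N_pos] by auto
    fix u v assume "u \<in> verts (with_proj G)" "v \<in> verts (with_proj G)"
    then show "u \<rightarrow>\<^sup>*\<^bsub>with_proj G\<^esub> v"
      using awalk_dst[of v u] by (auto intro: G.reachable_awalkI)
  qed
  then show ?thesis by (simp add: Digraph_Component.connected_def eq)
qed

section \<open>Zombie moves in terms of distance\<close>

text \<open>The tail of the geodesic has length at least \<open>dst x z'\<close>, the whole at most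
  \<open>dst x z\<close>; \<open>dst_arc\<close> then forces equality.\<close>

lemma zombie_step_dst:
  assumes "zombie_step G x z z'"
  shows "(z, z') \<in> parcs G" "dst x z = Suc (dst x z')"
proof -
  obtain p where p: "G.awalk z ((z, z') # p) x"
      "\<And>q. G.awalk z q x \<Longrightarrow> Suc (length p) \<le> length q"
    using assms by (auto simp: zombie_step_def geodesic_def)
  then show arc: "(z, z') \<in> parcs G" by (auto simp: G.awalk_Cons_iff)
  have p': "G.awalk z' p x" using p by (auto simp: G.awalk_Cons_iff)
  have x: "x \<in> pverts G" using G.awalk_last_in_verts[OF p'] .
  have "z \<in> pverts G" using arc by (rule G.in_arcsD1)
  then obtain q where "G.awalk z q x" "length q = dst x z" using awalk_dst x by blast
  with p(2) have "Suc (length p) \<le> dst x z" by metis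
  then show "dst x z = Suc (dst x z')"
    using dst_le_length_awalk[OF p'] dst_arc[OF x arc] by simp
qed

lemma arc_vt_cases:
  assumes "(vt c p, z') \<in> parcs G" "p < L c"
  shows "(if p = 0 then \<exists>c'. z' = vt c' 1 \<or> z' = vt c' (L c' - 1)
    else z' = vt c (Suc p) \<or> z' = vt c (p - 1))"
  using assms(1)
proof (cases rule: arc_cases)
  case (1 c' p')
  then show ?thesis using assms(2) by (auto simp: vt_eq_iff vt_eq_hub_iff)
next
  case (2 c' p')
  then have "vt c p = vt c' (cycle_suc (L c') p')" by (simp add: vt_Suc)
  with 2 show ?thesis using assms(2)
    by (auto simp: vt_eq_iff vt_eq_hub_iff cycle_suc_less cycle_suc_def split: if_splits)
qed

lemma dst_self: "x \<in> pverts G \<Longrightarrow> dst x x = 0"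
  by (simp add: dst_eq_0_iff)

lemma dst_via_hub:
  assumes "c \<noteq> h"
  shows "dst (vt c q) (vt h p) = dst (vt c q) hub + dst hub (vt h p)"
proof -
  have "dst (vt c q) (vt h p) = dst (vt c q) (vt c 0) + dst (vt h 0) (vt h p)"
    using assms dst_vt[of "q mod L c" c "p mod L h" h] dst_vt[of "q mod L c" c 0 c]
      dst_vt[of 0 h "p mod L h" h]
    by (simp add: cycle_dist_commute[of _ 0] del: vt_0)
  then show ?thesis by simp
qed

text \<open>Selects one cycle through each vertex; the hub, lying on all of them, gets cycle
  0.\<close>

definition home :: "nat \<Rightarrow> nat" where
  "home z = fst (prod_decode z)"

lemma in_range_vt_home: "z \<in> pverts G \<Longrightarrow> z \<in> range (vt (home z))"
proof (elim pverts_G_cases)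
  fix c p assume "z = vt c p" "p < L c"
  then show ?thesis
    by (cases "p = 0") (auto simp: home_def vt_def hub_def image_iff intro!: exI[of _ 0] exI[of _ p])
qed

end

section \<open>The walk of the survivor\<close>

text \<open>The survivor runs once around cycle \<open>c n\<close> in round \<open>n\<close>; cycles
  may recur.\<close>

locale itinerary = bouquet +
  fixes c :: "nat \<Rightarrow> nat"
  assumes c_less: "c n < N"
begin

definition start :: "nat \<Rightarrow> nat" where
  "start n = (\<Sum>i<n. L (c i))"

definition walk :: "nat \<Rightarrow> nat" where
  "walk u = (let n = LEAST n. u < start (Suc n) in vt (c n) (u - start n))"

lemma start_0 [simp]: "start 0 = 0" and start_Suc: "start (Suc n) = start n + L (c n)"
  by (auto simp: start_def)

lemma start_mono: "m \<le> n \<Longrightarrow> start m \<le> start n"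
  by (auto simp: start_def intro!: sum_mono2)

lemma le_start: "n \<le> start n"
proof (induction n)
  case (Suc n)
  then show ?case using L_pos(1)[of "c n"] by (simp add: start_Suc del: L_pos)
qed simp

lemma stage_exists: "\<exists>n. start n \<le> u \<and> u < start (Suc n)"
proof -
  define n where "n = (LEAST n. u < start (Suc n))"
  have "u < start (Suc u)" using le_start[of "Suc u"] by simp
  then have "u < start (Suc n)" unfolding n_def by (rule LeastI)
  moreover have "start n \<le> u"
  proof (cases n)
    case (Suc m)
    then have "\<not> u < start (Suc m)"
      using not_less_Least[of m "\<lambda>n. u < start (Suc n)"] n_def by auto
    then show ?thesis using Suc by simp
  qed simp
  ultimately show ?thesis by blast
qed

lemma stage_unique: "start n \<le> u \<Longrightarrow> u < start (Suc n) \<Longrightarrow> (LEAST n. u < start (Suc n)) = n"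
  by (rule Least_equality) (metis leD le_trans not_less_eq_eq start_mono)+

lemma walk_start: "walk (start n) = hub"
  using stage_unique[of n "start n"] by (simp add: walk_def start_Suc)

text \<open>At the right endpoint both adjoining rounds give the hub; including it spares a case
  split for a step that ends a round.\<close>

lemma walk_eq:
  assumes "start n \<le> u" "u \<le> start (Suc n)"
  shows "walk u = vt (c n) (u - start n)"
proof (cases "u = start (Suc n)")
  case True
  then show ?thesis using walk_start[of "Suc n"] by (simp add: start_Suc)
next
  case False
  with assms show ?thesis using stage_unique[of n u] by (simp add: walk_def)
qed

lemma walk_in_vt: "\<exists>n q. walk u = vt (c n) q"
  by (auto simp: walk_def Let_def)

lemma walk_in_pverts: "walk u \<in> pverts G"
  using walk_in_vt[of u] vt_in_pverts[OF c_less] by metis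

lemma walk_arc: "(walk u, walk (Suc u)) \<in> parcs G"
proof -
  obtain n where n: "start n \<le> u" "u < start (Suc n)" using stage_exists by blast
  then show ?thesis
    using walk_eq[of n u] walk_eq[of n "Suc u"] arc_SucI(1)[OF c_less[of n], of "u - start n"]
    by (simp add: Suc_diff_le)
qed

section \<open>The walk and its delayed copy\<close>

text \<open>As \<open>d\<close> is below half of every length used from round \<open>n\<close> on,
  the \<open>d\<close> steps before time \<open>u\<close> meet at most two consecutive
  rounds.\<close>

lemma walk_segment_cases [consumes 2, case_names same next_stage]:
  assumes "start n + d \<le> u" and short: "\<forall>p\<ge>n. 2 * d < L (c p)"
  obtains (same) a p where "n \<le> a" "p + d < L (c a)" "walk (u - d) = vt (c a) p"
      "walk (Suc (u - d)) = vt (c a) (Suc p)" "walk u = vt (c a) (p + d)"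
    | (next_stage) a p q where "n \<le> a" "p + d = L (c a) + q" "0 < p" "p < L (c a)" "q < L (c (Suc a))"
      "walk (u - d) = vt (c a) p" "walk (Suc (u - d)) = vt (c a) (Suc p)" "walk u = vt (c (Suc a)) q"
proof -
  obtain a where a: "start a \<le> u - d" "u - d < start (Suc a)" using stage_exists by blast
  have n: "n \<le> a"
  proof (rule ccontr)
    assume "\<not> n \<le> a"
    then have "start (Suc a) \<le> start n" by (intro start_mono) simp
    with assms(1) a(2) show False by simp
  qed
  define p where "p = u - d - start a"
  have p: "walk (u - d) = vt (c a) p" "walk (Suc (u - d)) = vt (c a) (Suc p)"
    using a walk_eq[of a "u - d"] walk_eq[of a "Suc (u - d)"] by (simp_all add: p_def Suc_diff_le)
  have u: "u = start a + p + d" using a assms(1) by (simp add: p_def)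
  show thesis
  proof (cases "u < start (Suc a)")
    case True
    then have "walk u = vt (c a) (p + d)" using walk_eq[of a u] u by simp
    with True u show thesis using n p by (intro same) (simp_all add: start_Suc)
  next
    case False
    define q where "q = u - start (Suc a)"
    have q: "p + d = L (c a) + q" using False u by (simp add: q_def start_Suc)
    have "p < L (c a)" using a u by (simp add: start_Suc)
    moreover have "0 < p" using q short[rule_format, OF n] by (cases p) auto
    moreover have "q < L (c (Suc a))" using q \<open>p < L (c a)\<close> short[rule_format, of "Suc a"] n by simp
    moreover have "walk u = vt (c (Suc a)) q"
      using False \<open>q < L (c (Suc a))\<close> by (subst walk_eq[of "Suc a"]) (simp_all add: q_def start_Suc)
    ultimately show thesis using n p q by (intro next_stage)
  qed
qed

lemma dst_walk:
  assumes "start n + d \<le> u" and short: "\<forall>p\<ge>n. 2 * d < L (c p)"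
  shows "dst (walk u) (walk (u - d)) = d"
  using assms
proof (cases rule: walk_segment_cases)
  case (same a p)
  then show ?thesis using short[rule_format, of a] by (simp add: dst_vt cycle_dist_add)
next
  case (next_stage a p q)
  \<comment> \<open>Fact \<open>1\<close> serves two rounds on the same cycle; \<open>2\<close> and
    \<open>3\<close> serve the way through the hub to a different cycle.\<close>
  have "p = q + (L (c a) - d)" using next_stage short[rule_format, of a] by simp
  then have 1: "cycle_dist (L (c a)) q p = d"
    using short[rule_format, OF \<open>n \<le> a\<close>] cycle_dist_add[of "L (c a)" q "L (c a) - d"]
    by (simp add: cycle_dist_commute)
  have 2: "cycle_dist (L (c a)) p 0 = d - q"
    using cycle_dist_add[of "L (c a)" 0 p] next_stage short[rule_format, of a] by simp
  have 3: "cycle_dist (L (c (Suc a))) q 0 = q"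
    using cycle_dist_add[of "L (c (Suc a))" 0 q] next_stage short[rule_format, of "Suc a"] by simp
  show ?thesis using next_stage 1 2 3 by (simp add: dst_vt)
qed

text \<open>Shortest paths are unique here. On a cycle of length \<open>l\<close>, a step back
  leaves arcs \<open>d + 1\<close> and \<open>l - d - 1\<close>, both at least \<open>d\<close>
  since \<open>2 * d < l\<close>. Entering another cycle at the hub gains nothing either.\<close>

lemma walk_pursuit:
  assumes "start n + d \<le> u" and short: "\<forall>p\<ge>n. 2 * d < L (c p)"
    and z': "(walk (u - d), z') \<in> parcs G" "dst (walk u) z' < d"
  shows "z' = walk (Suc (u - d))"
  using assms(1) short
proof (cases rule: walk_segment_cases)
  case (same a p)
  have s: "2 * d < L (c a)" using short \<open>n \<le> a\<close> by blast
  have p: "p < L (c a)" using same by simp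
  note arc = arc_vt_cases[OF z'(1)[unfolded same] p]
  show ?thesis
  proof (cases "p = 0")
    case True
    with arc obtain h where "z' = vt h 1 \<or> z' = vt h (L h - 1)" by auto
    then show ?thesis
    proof (cases "h = c a")
      case h: True
      have "d \<le> dst (walk u) (vt h (L h - 1))"
        using same True h s cycle_dist_add[of "L (c a)" d "L (c a) - 1 - d"]
        by (simp add: dst_vt cycle_dist_commute)
      then show ?thesis
        using \<open>z' = vt h 1 \<or> _\<close> z'(2) h same True by auto
    next
      case False
      have "d \<le> dst (walk u) (vt h r)" for r
        using False same True s dst_via_hub[of "c a" h d r] cycle_dist_add[of "L (c a)" 0 d]
          dst_vt[of d "c a" 0 "c a"] by simp
      then show ?thesis using \<open>z' = vt h 1 \<or> _\<close> z'(2) by (metis not_le)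
    qed
  next
    case False
    have "d \<le> dst (walk u) (vt (c a) (p - 1))"
      using same p False s cycle_dist_add[of "L (c a)" "p - 1" "Suc d"] by (simp add: dst_vt)
    then show ?thesis using arc False z'(2) same by auto
  qed
next
  case (next_stage a p q)
  have s: "2 * d < L (c a)" "2 * d < L (c (Suc a))" using short next_stage by auto
  \<comment> \<open>If the rounds use different cycles, the way leads through the hub, which is at
    least \<open>d - q\<close> away in both directions.\<close>
  have "d \<le> dst (walk u) (vt (c a) (p - 1))"
  proof (cases "c (Suc a) = c a")
    case True
    have "p - 1 = q + (L (c a) - d - 1)" using next_stage s by simp
    then have "cycle_dist (L (c a)) q (p - 1) \<ge> d"
      using s cycle_dist_add[of "L (c a)" q "L (c a) - d - 1"] by (simp add: cycle_dist_commute)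
    then show ?thesis using True next_stage by (simp add: dst_vt)
  next
    case False
    have "d - q \<le> p - 1" "d - q \<le> L (c a) - (p - 1)"
      using next_stage s by linarith+
    then have "cycle_dist (L (c a)) (p - 1) 0 \<ge> d - q"
      using cycle_dist_add[of "L (c a)" 0 "p - 1"] by simp
    moreover have "cycle_dist (L (c (Suc a))) q 0 = q"
      using cycle_dist_add[of "L (c (Suc a))" 0 q] next_stage s by simp
    ultimately show ?thesis using False next_stage by (simp add: dst_vt)
  qed
  then show ?thesis using arc_vt_cases[OF z'(1)[unfolded next_stage] \<open>p < L (c a)\<close>] next_stage z'(2) by auto
qed

end

section \<open>Zombies behind the survivor\<close>

text \<open>
  A zombie from cycle \<open>h\<close> that arrives at the hub at time \<open>\<tau>\<close>, in round \<open>n\<close> of the survivor.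
\<close>

locale late_zombie = itinerary +
  fixes h \<tau> n :: nat
  assumes h: "h \<notin> range c"
    and arrival: "start n + 2 \<le> \<tau>"
    and short: "\<forall>p\<ge>n. 2 * (\<tau> - start n) < L (c p)"
begin

text \<open>Before the arrival only the distance to the hub is fixed, not the position, since a
  zombie opposite to the hub may choose its side. The later delay is the survivor's lead over the
  hub at the arrival.\<close>

definition zombie_at :: "nat \<Rightarrow> nat \<Rightarrow> bool" where
  "zombie_at u z \<longleftrightarrow>
    (if u < \<tau> then z \<in> range (vt h) \<and> u + dst hub z = \<tau> else z = walk (u - (\<tau> - start n)))"

lemma hub_in_pverts: "hub \<in> pverts G"
  using vt_in_pverts[OF N_pos, of 0] by simp

lemma approaching_not_on_walk:
  assumes "zombie_at u z" "u < \<tau>"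
  shows "z \<noteq> walk v"
proof
  assume z: "z = walk v"
  obtain m q where "walk v = vt (c m) q" using walk_in_vt by blast
  then have q: "vt (c m) (q mod L (c m)) = z" using z by simp
  obtain p where "z = vt h p" using assms by (auto simp: zombie_at_def)
  then have p: "vt h (p mod L h) = z" by simp
  have "c m \<noteq> h" using h by auto
  then have "p mod L h = 0"
    using p q vt_eq_iff[of "p mod L h" h "q mod L (c m)" "c m"] by simp
  with p have "z = hub" by (metis vt_0)
  with assms show False using dst_self[OF hub_in_pverts] by (simp add: zombie_at_def)
qed

lemma not_caught:
  assumes "zombie_at u z"
  shows "z \<noteq> walk u"
proof (cases "u < \<tau>")
  case False
  then have "dst (walk u) z = \<tau> - start n"
    using assms arrival short dst_walk[of n "\<tau> - start n" u] by (simp add: zombie_at_def)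
  then show ?thesis using arrival dst_self[OF walk_in_pverts, of u] by auto
qed (use assms approaching_not_on_walk in blast)

text \<open>Between the zombies' move and the survivor's the delay is one smaller; it stays positive
  because the full delay is at least 2.\<close>

lemma not_catching:
  assumes "zombie_at (Suc u) z"
  shows "z \<noteq> walk u"
proof (cases "Suc u < \<tau>")
  case False
  have *: "\<forall>p\<ge>n. 2 * (\<tau> - start n - 1) < L (c p)"
    using short by (auto intro: le_less_trans[rotated])
  have "Suc u - (\<tau> - start n) = u - (\<tau> - start n - 1)" using arrival by simp
  then have "dst (walk u) z = \<tau> - start n - 1"
    using False assms arrival dst_walk[of n "\<tau> - start n - 1" u, OF _ *] by (simp add: zombie_at_def)
  then show ?thesis using arrival dst_self[OF walk_in_pverts, of u] by auto
qed (use assms approaching_not_on_walk in blast)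

lemma zombie_at_step:
  assumes "zombie_at u z" "zombie_step G (walk u) z z'"
  shows "zombie_at (Suc u) z'"
proof (cases "u < \<tau>")
  case True
  then have z: "u + dst hub z = \<tau>" using assms(1) by (simp add: zombie_at_def)
  obtain p where "z = vt h p" using True assms(1) by (auto simp: zombie_at_def)
  then have p: "z = vt h (p mod L h)" "p mod L h < L h" by simp_all
  have "z \<noteq> hub" using z True dst_self[OF hub_in_pverts] by auto
  then have "p mod L h \<noteq> 0" using p by (metis vt_0)
  then have "z' \<in> range (vt h)"
    using arc_vt_cases[OF _ p(2), of z'] zombie_step_dst(1)[OF assms(2)] p(1) by (auto split: if_splits)
  then obtain p' where p': "z' = vt h p'" by auto
  obtain m q where x: "walk u = vt (c m) q" using walk_in_vt by blast
  have "c m \<noteq> h" using h by auto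
  \<comment> \<open>The survivor is off cycle \<open>h\<close>, so \<open>z\<close> and
    \<open>z'\<close> have the same detour from the hub to him.\<close>
  then have "dst hub z = Suc (dst hub z')"
    using zombie_step_dst(2)[OF assms(2)] dst_via_hub[of "c m" h q p'] dst_via_hub[of "c m" h q p]
      x p' \<open>z = vt h p\<close> by simp
  show ?thesis
  proof (cases "Suc u < \<tau>")
    case True
    then show ?thesis using p' z \<open>dst hub z = _\<close> by (auto simp: zombie_at_def)
  next
    case False
    \<comment> \<open>Arrival: the hub is \<open>walk (start n)\<close>, the delayed position at
      time \<open>\<tau>\<close>.\<close>
    then have u: "Suc u = \<tau>" using True by simp
    then have "dst hub z' = 0" using z \<open>dst hub z = _\<close> by simp
    moreover have "z' \<in> pverts G" using G.in_arcsD2 zombie_step_dst(1)[OF assms(2)] .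
    ultimately have "z' = hub" using dst_eq_0_iff hub_in_pverts by metis
    moreover have "\<tau> - (\<tau> - start n) = start n" using arrival by simp
    ultimately show ?thesis using u walk_start[of n] by (simp add: zombie_at_def)
  qed
next
  case False
  define d where "d = \<tau> - start n"
  have d: "start n + d \<le> u" "\<forall>p\<ge>n. 2 * d < L (c p)" and z: "z = walk (u - d)"
    using False arrival short assms(1) by (simp_all add: d_def zombie_at_def)
  have "dst (walk u) z' < d"
    using zombie_step_dst(2)[OF assms(2)] dst_walk[OF d] z by simp
  then have "z' = walk (Suc (u - d))"
    using walk_pursuit[OF d] zombie_step_dst(1)[OF assms(2)] z by simp
  moreover have "Suc (u - d) = Suc u - d" using d by simp
  ultimately show ?thesis using False by (simp add: zombie_at_def d_def)
qed

end

context itinerary begin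

lemma survivor_trajectory_walk: "survivor_trajectory G (\<lambda>t. walk (t + m))"
  by (simp add: survivor_trajectory_def walk_in_pverts walk_arc)

text \<open>
  Time \<open>u\<close> of the walk is round \<open>u - 2\<close> of the game: the survivor starts two steps past the hub,
  where even a zombie placed on the hub is far enough behind him.
\<close>

lemma walk_evades:
  assumes legal: "legal_strategy G \<sigma>"
    and homes: "\<And>z. z \<in> set (\<sigma> []) \<Longrightarrow> home z \<notin> range c"
    and joins: "\<And>z. z \<in> set (\<sigma> []) \<Longrightarrow> \<exists>n. start n + 2 \<le> dst hub z + 2 \<and>
      (\<forall>p\<ge>n. 2 * (dst hub z + 2 - start n) < L (c p))"
  shows "\<not> caught_before \<sigma> (\<lambda>t. walk (t + 2)) t"
proof -
  define s where "s = (\<lambda>t. walk (t + 2))"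
  obtain n where n: "\<And>z. z \<in> set (\<sigma> []) \<Longrightarrow> start (n z) + 2 \<le> dst hub z + 2 \<and>
      (\<forall>p\<ge>n z. 2 * (dst hub z + 2 - start (n z)) < L (c p))"
    using joins by metis
  \<comment> \<open>The initial position \<open>z0\<close> fixes the parameters of a zombie now at
    \<open>z\<close>; its arrival time adds 2 because the game begins at time 2 of the walk.\<close>
  define Z where "Z u z0 z \<longleftrightarrow> z0 \<in> set (\<sigma> []) \<and>
      late_zombie.zombie_at L c (home z0) (dst hub z0 + 2) (n z0) u z" for u z0 z
  have zombie: "late_zombie L N c (home z0) (dst hub z0 + 2) (n z0)" if "z0 \<in> set (\<sigma> [])" for z0
    using that homes n by unfold_locales auto
  have verts: "set (\<sigma> []) \<subseteq> pverts G" using legal by (simp add: legal_strategy_def)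
  have Z_init: "Z 2 z0 z0" if z0: "z0 \<in> set (\<sigma> [])" for z0
  proof -
    interpret late_zombie L N c "home z0" "dst hub z0 + 2" "n z0" by (rule zombie[OF z0])
    have "z0 \<in> pverts G" using z0 verts by blast
    have "zombie_at 2 z0"
    proof (cases "dst hub z0 = 0")
      case True
      \<comment> \<open>A zombie placed on the hub has already arrived, with delay 2 behind a round
        starting at time 0.\<close>
      then have "z0 = hub" using dst_eq_0_iff hub_in_pverts \<open>z0 \<in> pverts G\<close> by metis
      moreover have "start (n z0) = 0" using n[OF z0] True by simp
      ultimately show ?thesis unfolding zombie_at_def using True walk_start[of 0] by simp
    next
      case False
      then show ?thesis unfolding zombie_at_def
        using in_range_vt_home[OF \<open>z0 \<in> pverts G\<close>] by simp
    qed
    with z0 show ?thesis by (simp add: Z_def)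
  qed
  have Z_step: "Z (Suc u) z0 z'" if "Z u z0 z" "zombie_step G (walk u) z z'" for u z0 z z'
    using that late_zombie.zombie_at_step[OF zombie] by (auto simp: Z_def)
  have Z_free: "z \<noteq> walk u" if "Z u z0 z" for u z0 z
    using that late_zombie.not_caught[OF zombie] by (auto simp: Z_def)
  have Z_free': "z \<noteq> walk u" if "Z (Suc u) z0 z" for u z0 z
    using that late_zombie.not_catching[OF zombie] by (auto simp: Z_def)
  have tracked: "\<exists>z0. Z u z0 z" if "list_all2 (Z u) xs ys" "z \<in> set ys" for u xs ys z
    using that by (auto simp: in_set_conv_nth list_all2_conv_all_nth)
  have free: "walk u \<notin> set ys" if "list_all2 (Z u) xs ys" for u xs ys
    using that tracked Z_free by metis
  have free': "walk u \<notin> set ys" if "list_all2 (Z (Suc u)) xs ys" for u xs ys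
    using that tracked Z_free' by metis
  \<comment> \<open>The claims need each other: the rules bind the zombies only while the survivor
    is free, and tracking them shows that he stays free.\<close>
  have "\<not> caught_before \<sigma> s t \<and> list_all2 (Z (t + 2)) (\<sigma> []) (zombie_pos \<sigma> s t)"
  proof (induction t)
    case 0
    have Z: "list_all2 (Z 2) (\<sigma> []) (zombie_pos \<sigma> s 0)"
      using Z_init by (auto simp: zombie_pos_def list_all2_same)
    then have "s 0 \<notin> set (zombie_pos \<sigma> s 0)"
      unfolding s_def add_0 by (rule free)
    with Z show ?case by (auto simp: caught_before_def numeral_2_eq_2)
  next
    case (Suc t)
    have "survivor_trajectory G s" unfolding s_def by (rule survivor_trajectory_walk)
    then have "list_all2 (zombie_step G (s t)) (zombie_pos \<sigma> s t) (zombie_pos \<sigma> s (Suc t))"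
      using legal Suc unfolding legal_strategy_def by blast
    then have step: "list_all2 (zombie_step G (walk (t + 2))) (zombie_pos \<sigma> s t) (zombie_pos \<sigma> s (Suc t))"
      by (simp only: s_def)
    have Z: "list_all2 (Z (Suc (t + 2))) (\<sigma> []) (zombie_pos \<sigma> s (Suc t))"
      by (rule list_all2_trans[rotated, OF conjunct2[OF Suc] step]) (rule Z_step)
    then have "s (Suc t) \<notin> set (zombie_pos \<sigma> s (Suc t))" "s t \<notin> set (zombie_pos \<sigma> s (Suc t))"
      unfolding s_def add_Suc by (rule free, rule free')
    with Z Suc show ?case
      by (auto simp: caught_before_def le_Suc_eq less_Suc_eq)
  qed
  then show ?thesis by (simp add: s_def)
qed

end

section \<open>Choosing the cycles\<close>

definition len :: "nat \<Rightarrow> nat" where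
  "len i = 8 * 4 ^ i"

lemma len_ge: "8 \<le> len i"
  by (simp add: len_def)

lemma len_mono: "i \<le> j \<Longrightarrow> len i \<le> len j"
  by (simp add: len_def)

lemma len_less: "i < j \<Longrightarrow> 4 * len i \<le> len j"
  using len_mono[of "Suc i" j] by (simp add: len_def)

text \<open>Level \<open>i\<close> is bad for \<open>t\<close> in the second half of a round of
  length \<open>len i\<close> from \<open>T\<close>, and less than 2 steps after its end, where the
  next delay would be too small. Each \<open>t\<close> spoils at most one level, so pigeonhole
  applies.\<close>

lemma level_avoiding_window:
  assumes "finite A" "card A \<le> m"
  shows "\<exists>i. j \<le> i \<and> i \<le> j + m \<and> (\<forall>t\<in>A. 2 * (t - T) < len i \<or> T + len i + 2 \<le> t)"
proof (rule ccontr)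
  assume none: "\<not> ?thesis"
  have "\<exists>t\<in>A. len i \<le> 2 * (t - T) \<and> t < T + len i + 2" if "i \<in> {j..j + m}" for i
    using none that by (meson atLeastAtMost_iff not_less not_le)
  then obtain t where t: "\<And>i. i \<in> {j..j + m} \<Longrightarrow> t i \<in> A"
      "\<And>i. i \<in> {j..j + m} \<Longrightarrow> len i \<le> 2 * (t i - T) \<and> t i < T + len i + 2"
    by metis
  \<comment> \<open>A common value \<open>t\<close> would give
    \<open>4 * len i \<le> len i' \<le> 2 * (t - T) < 2 * len i + 4\<close>, contradicting
    \<open>8 \<le> len i\<close>.\<close>
  have ne: "t i \<noteq> t i'" if "i \<in> {j..j + m}" "i' \<in> {j..j + m}" "i < i'" for i i'
    using t(2)[of i] t(2)[of i'] that len_less[of i i'] len_ge[of i] by auto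
  then have "inj_on t {j..j + m}"
    by (metis inj_onI linorder_neqE_nat)
  then have "card {j..j + m} \<le> card A"
    using t(1) assms(1) by (intro card_inj_on_le[of t]) auto
  with assms(2) show False by simp
qed

text \<open>The arrival conditions of \<open>late_zombie\<close> for rounds starting at time
  \<open>T\<close>; a variable \<open>T\<close> allows splitting off the first round in an
  induction.\<close>

definition joins_behind :: "(nat \<Rightarrow> nat) \<Rightarrow> nat \<Rightarrow> nat \<Rightarrow> bool" where
  "joins_behind lev T t \<longleftrightarrow> (\<exists>n. T + (\<Sum>i<n. len (lev i)) + 2 \<le> t \<and>
     (\<forall>p\<ge>n. 2 * (t - (T + (\<Sum>i<n. len (lev i)))) < len (lev p)))"

text \<open>Induction on the time \<open>B\<close> left for arrivals, choosing one round at a time.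
  The least level \<open>j\<close> is raised, to some \<open>i \<le> j + m\<close>, only if an
  arrival falls into the current round; then \<open>m\<close> drops by one. As
  \<open>m + (m - 1) * (m - 1) \<le> m * m\<close> for \<open>m \<ge> 1\<close>, the bound does not
  depend on \<open>B\<close>.\<close>

lemma itinerary_exists:
  assumes "finite A" "card A \<le> m" "\<And>t. t \<in> A \<Longrightarrow> T + 2 \<le> t"
  shows "\<exists>lev :: nat \<Rightarrow> nat. (\<forall>n. j \<le> lev n \<and> lev n \<le> j + m * m) \<and>
    (\<forall>t\<in>A. joins_behind lev T t)"
proof -
  obtain B where "\<And>t. t \<in> A \<Longrightarrow> t < T + B"
    using assms(1) by (metis finite_nat_set_iff_bounded trans_less_add2)
  with assms show ?thesis
  proof (induction B arbitrary: A T j m rule: less_induct)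
    case (less B)
    show ?case
    proof (cases "A = {}")
      case True
      then show ?thesis by (intro exI[of _ "\<lambda>_. j"]) auto
    next
      case False
      then have "0 < B" "0 < m" using less.prems by (fastforce, auto simp: card_gt_0_iff Suc_le_eq)
      obtain i where i: "j \<le> i" "i \<le> j + m"
          "\<And>t. t \<in> A \<Longrightarrow> 2 * (t - T) < len i \<or> T + len i + 2 \<le> t"
        using level_avoiding_window[OF less.prems(1,2)] by blast
      \<comment> \<open>Arrivals left for later rounds; all others lie in the first half of this
        one, and later rounds must not be shorter than it.\<close>
      define A' where "A' = {t \<in> A. T + len i + 2 \<le> t}"
      have packed: "2 * (t - T) < len i" if "t \<in> A - A'" for t
        using i(3)[of t] that by (auto simp: A'_def)
      obtain j' m' where j': "j \<le> j'" "j' + m' * m' \<le> j + m * m" "card A' \<le> m'" "A' = A \<or> i \<le> j'"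
      proof (cases "A' = A")
        case True
        then show thesis using less.prems by (intro that[of j m]) auto
      next
        case False
        then have "A' \<subset> A" by (auto simp: A'_def)
        then have "card A' < card A" using less.prems(1) by (rule psubset_card_mono[rotated])
        moreover obtain m' where "m = Suc m'" using \<open>0 < m\<close> by (cases m) auto
        ultimately show thesis using less.prems(2) i by (intro that[of i m']) auto
      qed
      have "\<exists>lev :: nat \<Rightarrow> nat. (\<forall>n. j' \<le> lev n \<and> lev n \<le> j' + m' * m') \<and>
        (\<forall>t\<in>A'. joins_behind lev (T + len i) t)"
      proof (rule less.IH[of "B - len i"])
        show "B - len i < B" using \<open>0 < B\<close> len_ge[of i] by simp
        show "finite A'" using less.prems(1) by (simp add: A'_def)
        show "t < T + len i + (B - len i)" if "t \<in> A'" for t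
          using less.prems(4)[of t] that by (auto simp: A'_def)
      qed (use j' in \<open>auto simp: A'_def\<close>)
      then obtain lev where lev: "\<And>n. j' \<le> lev n \<and> lev n \<le> j' + m' * m'"
        and late: "\<And>t. t \<in> A' \<Longrightarrow> joins_behind lev (T + len i) t" by blast
      define lev' where "lev' = case_nat i lev"
      have lev'_simps: "lev' 0 = i" "lev' (Suc n) = lev n" for n
        by (simp_all add: lev'_def)
      have sum: "(\<Sum>i<Suc n. len (lev' i)) = len i + (\<Sum>i<n. len (lev i))" for n
        unfolding sum.lessThan_Suc_shift by (simp add: lev'_simps)
      have "m \<le> m * m" using \<open>0 < m\<close> by simp
      then have bounds: "j \<le> lev' n \<and> lev' n \<le> j + m * m" for n
        using lev[of "n - 1"] j' i(1,2) by (cases n) (auto simp: lev'_simps intro: order_trans)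
      have "joins_behind lev' T t" if "t \<in> A" for t
      proof (cases "t \<in> A'")
        case True
        then obtain n where n: "T + len i + (\<Sum>i<n. len (lev i)) + 2 \<le> t"
          "\<And>p. p \<ge> n \<Longrightarrow> 2 * (t - (T + len i + (\<Sum>i<n. len (lev i)))) < len (lev p)"
          using late by (auto simp: joins_behind_def)
        have "2 * (t - (T + (\<Sum>i<Suc n. len (lev' i)))) < len (lev' p)" if "p \<ge> Suc n" for p
          using n(2)[of "p - 1"] that unfolding sum by (cases p) (auto simp: add.assoc lev'_simps)
        then show ?thesis unfolding joins_behind_def using n(1)
          by (intro exI[of _ "Suc n"]) (auto simp only: sum)
      next
        case False
        with that j' have "i \<le> lev' p" for p
          using lev[of "p - 1"] by (cases p) (auto simp: lev'_simps intro: order_trans)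
        then have "2 * (t - T) < len (lev' p)" for p
          using packed[of t] that False len_mono[of i "lev' p"] by (meson DiffI less_le_trans)
        then show ?thesis unfolding joins_behind_def using less.prems(3)[OF that]
          by (intro exI[of _ 0]) auto
      qed
      with bounds show ?thesis by blast
    qed
  qed
qed

section \<open>The zombie number\<close>

theorem theorem2:
  fixes k :: nat
  assumes "k \<ge> 1"
  shows "\<exists>G :: nat pair_pre_digraph.
           pair_graph G \<and> Digraph_Component.connected (with_proj G) \<and>
           cycles_sharing_vertex G \<and> zombie_number G \<ge> k"
proof -
  \<comment> \<open>There are \<open>k\<close> cycles of each length \<open>len i\<close> for
    \<open>i \<le> k * k\<close>, fixed before any zombies are placed.\<close>
  define L where "L c = len (c div k)" for c
  define N where "N = k * (k * k + 1)"
  interpret bouquet L N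
  proof
    show "3 \<le> L c" for c using len_ge[of "c div k"] by (simp add: L_def)
    show "0 < N" using assms by (simp add: N_def)
  qed
  have "k \<le> m" if win: "zombies_can_win G m" for m
  proof (rule ccontr)
    assume "\<not> k \<le> m"
    obtain \<sigma> where \<sigma>: "length (\<sigma> []) = m" "winning_strategy G \<sigma>"
      using win by (auto simp: zombies_can_win_def)
    define Z where "Z = set (\<sigma> [])"
    have "card Z < k" using \<sigma>(1) \<open>\<not> k \<le> m\<close> card_length[of "\<sigma> []"] by (simp add: Z_def)
    \<comment> \<open>Fewer than \<open>k\<close> zombies cannot have their homes on all
      \<open>k\<close> cycles of one length.\<close>
    have "\<exists>c. c div k = i \<and> c \<notin> home ` Z" for i
    proof -
      have "card (home ` Z) < card {i * k..<i * k + k}"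
        using card_image_le[of Z home] \<open>card Z < k\<close> by (simp add: Z_def)
      then have "\<not> {i * k..<i * k + k} \<subseteq> home ` Z"
        by (metis List.finite_set Z_def card_mono finite_imageI not_less)
      then obtain c where "c \<in> {i * k..<i * k + k}" "c \<notin> home ` Z" by blast
      then show ?thesis by (intro exI[of _ c]) (auto intro!: div_nat_eqI simp: ac_simps)
    qed
    then obtain f where f: "\<And>i. f i div k = i" "\<And>i. f i \<notin> home ` Z" by metis
    define A where "A = (\<lambda>z. dst hub z + 2) ` Z"
    have "card A \<le> k" using card_image_le[of Z "\<lambda>z. dst hub z + 2"] \<open>card Z < k\<close>
      by (simp add: A_def Z_def)
    moreover have "finite A" "\<And>t. t \<in> A \<Longrightarrow> 0 + 2 \<le> t"
      by (auto simp: A_def Z_def)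
    ultimately obtain lev where lev: "\<And>n. lev n \<le> k * k" "\<And>t. t \<in> A \<Longrightarrow> joins_behind lev 0 t"
      using itinerary_exists[OF \<open>finite A\<close> \<open>card A \<le> k\<close> \<open>\<And>t. t \<in> A \<Longrightarrow> 0 + 2 \<le> t\<close>, of 0] by auto
    define c where "c n = f (lev n)" for n
    have "f (lev n) < N" for n
    proof -
      have "f (lev n) div k < k * k + 1" using f(1) lev(1)[of n] by simp
      then show ?thesis using assms by (simp add: N_def div_less_iff_less_mult mult.commute)
    qed
    then interpret itinerary L N c
      by unfold_locales (simp add: c_def)
    have L_c: "L (c n) = len (lev n)" for n
      by (simp add: L_def c_def f)
    have "\<not> caught_before \<sigma> (\<lambda>t. walk (t + 2)) t" for t
    proof (rule walk_evades)
      show "legal_strategy G \<sigma>" using \<sigma>(2) by (simp add: winning_strategy_def)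
      fix z assume z: "z \<in> set (\<sigma> [])"
      then show "home z \<notin> range c" using f(2) by (metis Z_def c_def image_eqI rangeE)
      have "joins_behind lev 0 (dst hub z + 2)" using z lev(2) by (simp add: A_def Z_def)
      then show "\<exists>n. start n + 2 \<le> dst hub z + 2 \<and>
          (\<forall>p\<ge>n. 2 * (dst hub z + 2 - start n) < L (c p))"
        unfolding joins_behind_def L_c start_def by simp
    qed
    with \<sigma>(2) survivor_trajectory_walk show False unfolding winning_strategy_def by blast
  qed
  with zombies_can_win_zombie_number[OF pair_graph_G] have "k \<le> zombie_number G" by blast
  with pair_graph_G connected_G cycles_sharing_vertex_G show ?thesis by blast
qed

end
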